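(* Let $A=M_n(K)$ be a split algebra of $2$-power degree $n=2^\ell$, equipped with a hyperbolic involution $\sigma$ of any kind (orthogonal, symplectic or unitary). Let $F$ be the fixed field of $(A,\sigma)$, assumed formally real. Then the PS Conjecture holds for $(A,\sigma)$.
   Context: An involution $\sigma$ on a central simple algebra $A$ (a ring anti-automorphism with $\sigma^2=\mathrm{id}$) is hyperbolic if there exists an idempotent $e\in A$ such that $\sigma(e)=1-e$ (equivalently, the quadratic, alternating or hermitian form to which $\sigma$ is adjoint is hyperbolic). Let $(A,\sigma)$ be a (finite-dimensional) central simple algebra with centre $K$ and involution $\sigma$. Its fixed field is $F=\{x\in K:\sigma(x)=x\}$. The involution is of the first kind if $K=F$ and of the second kind (unitary) otherwise; in the latter case $[K:F]=2$ and $\sigma|_K$ is the non-trivial element of $\mathrm{Gal}(K/F)$. An involution of the first kind is orthogonal or symplectic if, after scalar extension to a splitting field, it is adjoint to a quadratic or alternating form, respectively. Let $\mathrm{Trd}:A\to F$ denote the reduced trace $\mathrm{Trd}_{A/F}$ if $\sigma$ is of the first kind, and the composition $\mathrm{Trd}_{K/F}\circ\mathrm{Trd}_{A/K}$ of the reduced trace with the trace of $K/F$ if $\sigma$ is of the second kind. Put $\mathrm{Sym}(A,\sigma)=\{a\in A:\sigma(a)=a\}$. An ordering $\leq_P$ of $F$ is a $\sigma$-ordering if $0\leq_P\mathrm{Trd}(\sigma(x)x)$ for all $x\in A$. An element $a\in\mathrm{Sym}(A,\sigma)$ is $\sigma$-positive with respect to a $\sigma$-ordering $\leq_P$ if $0\leq_P\mathrm{Trd}(\sigma(x)ax)$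 for all $x\in A$; it is totally $\sigma$-positive if it is $\sigma$-positive with respect to all $\sigma$-orderings of $F$ (a vacuous condition if there are none). Hermitian squares in $(A,\sigma)$ are elements $\sigma(x)x$ with $x\in A$; sums are finite. "The PS Conjecture holds for $(A,\sigma)$" means: every totally $\sigma$-positive element of $A$ is a sum of hermitian squares in $(A,\sigma)$. *)

theory Defs
  imports "HOL-Analysis.Determinants"
begin

text \<open>
  The algebra \<open>A = M\<^sub>n(K)\<close> is the type \<open>'k^'n^'n\<close> with product \<open>**\<close>, where \<open>K\<close> is the type \<open>'k\<close> and
  \<open>n = CARD('n)\<close>.  The centre of \<open>A\<close> consists of the scalar matrices \<open>mat c\<close>; it is identified
  with \<open>K\<close> throughout.
\<close>

definition involution :: "('k::field^'n^'n \<Rightarrow> 'k^'n^'n) \<Rightarrow> bool" where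
  "involution \<sigma> \<longleftrightarrow>
     (\<forall>x y. \<sigma> (x + y) = \<sigma> x + \<sigma> y) \<and>
     (\<forall>x y. \<sigma> (x ** y) = \<sigma> y ** \<sigma> x) \<and>
     \<sigma> (mat 1) = mat 1 \<and>
     (\<forall>x. \<sigma> (\<sigma> x) = x)"

definition hyperbolic :: "('k::field^'n^'n \<Rightarrow> 'k^'n^'n) \<Rightarrow> bool" where
  "hyperbolic \<sigma> \<longleftrightarrow> (\<exists>e. e ** e = e \<and> \<sigma> e = mat 1 - e)"

definition fixed_field :: "('k::field^'n^'n \<Rightarrow> 'k^'n^'n) \<Rightarrow> 'k set" where
  "fixed_field \<sigma> = {c. \<sigma> (mat c) = mat c}"

definition first_kind :: "('k::field^'n^'n \<Rightarrow> 'k^'n^'n) \<Rightarrow> bool" where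
  "first_kind \<sigma> \<longleftrightarrow> fixed_field \<sigma> = UNIV"

text \<open>The restriction of \<open>\<sigma>\<close> to the centre; \<open>centre_conj\<close> below shows that it is well defined.\<close>

definition conj_on_centre :: "('k::field^'n^'n \<Rightarrow> 'k^'n^'n) \<Rightarrow> 'k \<Rightarrow> 'k" where
  "conj_on_centre \<sigma> c = (THE d. \<sigma> (mat c) = mat d)"

lemma mat_eq_iff: "(mat c :: 'k::field^'n^'n) = mat d \<longleftrightarrow> c = d"
  by (auto simp: mat_def vec_eq_iff)

lemma if_mult_zero:
  "(if b then x else 0) * y = (if b then x * y else (0 :: 'k::field))"
  "y * (if b then x else 0) = (if b then y * x else (0 :: 'k::field))"
  by simp_all

lemma central_imp_scalar:
  fixes a :: "'k::field^'n^'n"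
  assumes comm: "\<And>b. a ** b = b ** a"
  shows "\<exists>d. a = mat d"
proof -
  define E :: "'n \<Rightarrow> 'n \<Rightarrow> 'k^'n^'n"
    where "E p q = (\<chi> i j. if i = p \<and> j = q then 1 else 0)" for p q
  have r: "(a ** E p q) $ i $ j = (if j = q then a $ i $ p else 0)" for p q i j
    by (cases "j = q") (simp_all add: matrix_matrix_mult_def E_def if_mult_zero)
  have l: "(E p q ** a) $ i $ j = (if i = p then a $ q $ j else 0)" for p q i j
    by (cases "i = p") (simp_all add: matrix_matrix_mult_def E_def if_mult_zero)
  have e: "(if j = q then a $ i $ p else 0) = (if i = p then a $ q $ j else 0)" for p q i j
    using comm[of "E p q"] r[where p=p and q=q and i=i and j=j] l[where p=p and q=q and i=i and j=j] by simp
  have diag: "a $ i $ i = a $ j $ j" for i j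
    using e[where p=i and q=j and i=i and j=j] by simp
  have off: "a $ i $ j = 0" if "i \<noteq> j" for i j
    using e[where p=j and q=j and i=i and j=j] that by simp
  have "a = mat (a $ i $ i)" for i
    unfolding mat_def vec_eq_iff using diag off by auto
  then show ?thesis by blast
qed

lemma scalar_central: "(mat c :: 'k::field^'n^'n) ** b = b ** mat c"
proof -
  have "(mat c ** b) $ i $ j = (b ** mat c) $ i $ j" for i j
    by (simp add: matrix_matrix_mult_def mat_def if_mult_zero)
  then show ?thesis by (simp add: vec_eq_iff)
qed

lemma centre_conj:
  assumes "involution \<sigma>"
  shows "\<sigma> (mat c) = mat (conj_on_centre \<sigma> c)"
proof -
  have "\<sigma> (mat c) ** b = b ** \<sigma> (mat c)" for b
    using assms scalar_central unfolding involution_def by metis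
  then obtain d where d: "\<sigma> (mat c) = mat d"
    using central_imp_scalar by blast
  then show ?thesis
    by (simp add: conj_on_centre_def mat_eq_iff)
qed

text \<open>
  \<open>Trd : A \<rightarrow> F\<close>.  As \<open>A\<close> is a full matrix algebra over \<open>K\<close>, its reduced trace over \<open>K\<close> is the matrix
  trace.  In the second kind, \<open>K/F\<close> is quadratic with non-trivial automorphism \<open>conj_on_centre \<sigma>\<close>,
  so the trace of \<open>K/F\<close> is \<open>c \<mapsto> c + conj_on_centre \<sigma> c\<close>.
\<close>

definition Trd :: "('k::field^'n^'n \<Rightarrow> 'k^'n^'n) \<Rightarrow> 'k^'n^'n \<Rightarrow> 'k" where
  "Trd \<sigma> a = (if first_kind \<sigma> then trace a else trace a + conj_on_centre \<sigma> (trace a))"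

definition Sym :: "('k::field^'n^'n \<Rightarrow> 'k^'n^'n) \<Rightarrow> ('k^'n^'n) set" where
  "Sym \<sigma> = {a. \<sigma> a = a}"

text \<open>Below, \<open>F\<close> is a subfield of \<open>K\<close>, and \<open>(x, y) \<in> P\<close> stands for \<open>x \<le>\<^sub>P y\<close>.\<close>

definition formally_real :: "'k::field set \<Rightarrow> bool" where
  "formally_real F \<longleftrightarrow> \<not> (\<exists>xs. set xs \<subseteq> F \<and> - 1 = (\<Sum>x\<leftarrow>xs. x\<^sup>2))"

definition field_ordering :: "'k::field set \<Rightarrow> 'k rel \<Rightarrow> bool" where
  "field_ordering F P \<longleftrightarrow>
     linear_order_on F P \<and>
     (\<forall>x\<in>F. \<forall>y\<in>F. \<forall>z\<in>F. (x, y) \<in> P \<longrightarrow> (x + z, y + z) \<in> P) \<and>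
     (\<forall>x\<in>F. \<forall>y\<in>F. (0, x) \<in> P \<longrightarrow> (0, y) \<in> P \<longrightarrow> (0, x * y) \<in> P)"

definition sigma_ordering :: "('k::field^'n^'n \<Rightarrow> 'k^'n^'n) \<Rightarrow> 'k rel \<Rightarrow> bool" where
  "sigma_ordering \<sigma> P \<longleftrightarrow>
     field_ordering (fixed_field \<sigma>) P \<and> (\<forall>x. (0, Trd \<sigma> (\<sigma> x ** x)) \<in> P)"

definition sigma_positive :: "('k::field^'n^'n \<Rightarrow> 'k^'n^'n) \<Rightarrow> 'k rel \<Rightarrow> 'k^'n^'n \<Rightarrow> bool" where
  "sigma_positive \<sigma> P a \<longleftrightarrow> (\<forall>x. (0, Trd \<sigma> (\<sigma> x ** a ** x)) \<in> P)"

definition totally_sigma_positive :: "('k::field^'n^'n \<Rightarrow> 'k^'n^'n) \<Rightarrow> 'k^'n^'n \<Rightarrow> bool" where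
  "totally_sigma_positive \<sigma> a \<longleftrightarrow>
     a \<in> Sym \<sigma> \<and> (\<forall>P. sigma_ordering \<sigma> P \<longrightarrow> sigma_positive \<sigma> P a)"

definition sum_of_hermitian_squares :: "('k::field^'n^'n \<Rightarrow> 'k^'n^'n) \<Rightarrow> 'k^'n^'n \<Rightarrow> bool" where
  "sum_of_hermitian_squares \<sigma> a \<longleftrightarrow> (\<exists>xs. a = (\<Sum>x\<leftarrow>xs. \<sigma> x ** x))"

definition PS_Conjecture :: "('k::field^'n^'n \<Rightarrow> 'k^'n^'n) \<Rightarrow> bool" where
  "PS_Conjecture \<sigma> \<longleftrightarrow> (\<forall>a. totally_sigma_positive \<sigma> a \<longrightarrow> sum_of_hermitian_squares \<sigma> a)"

end

(*
  Let e be an idempotent with \<sigma>(e) = f, where f = 1 - e.  Since f e = e f = 0,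
    \<sigma>(e u + f v) (e u + f v) = \<sigma>(u) f v + \<sigma>(v) e u   for all u, v.
  Of two matrices, the one of smaller rank is a two-sided multiple of the other; as \<sigma> exchanges
  e and f, this gives e = g f h for some g, h.  For w = a / 2 with a symmetric, the pairs
  (u, v) = (1, w) and (u, v) = (\<sigma>(g), h w) produce f w + w e and e w + w f, which add up to a.
  So every symmetric element is a sum of two hermitian squares; the division by 2 is allowed
  because F is formally real.
*)
theory Submission
  imports Defs
begin

lemma matrix_add_rdistrib: "(A + B) ** C = A ** C + B ** (C :: 'k::semiring_1^'n^'m)"
  by (vector matrix_matrix_mult_def sum.distrib[symmetric] field_simps)

lemma matrix_sub_ldistrib: "A ** (B - C) = A ** B - A ** (C :: 'k::ring_1^'n^'m)"
  by (vector matrix_matrix_mult_def sum_subtractf[symmetric] right_diff_distrib)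

lemma matrix_sub_rdistrib: "(A - B) ** C = A ** C - B ** (C :: 'k::ring_1^'n^'m)"
  by (vector matrix_matrix_mult_def sum_subtractf[symmetric] left_diff_distrib)

text \<open>The smaller range embeds into the larger one: send a basis \<open>C\<close> of the range
  of \<open>A\<close> injectively into a basis \<open>D\<close> of the range of \<open>B\<close>.
  Lifting through \<open>B\<close> gives \<open>\<phi>\<close>, and a left inverse
  \<open>\<psi>\<close> of \<open>B\<close> after \<open>\<phi>\<close> on the span of
  \<open>C\<close> yields A = \<psi> B \<phi> A.\<close>

lemma factor_through_matrix_if_dim_le:
  fixes A B :: "'k::field^'n^'n"
  assumes "vec.dim (range ((*v) A)) \<le> vec.dim (range ((*v) B))"
  shows "\<exists>G H. A = G ** B ** H"
proof -
  obtain C where C: "vec.independent C" "range ((*v) A) \<subseteq> vec.span C"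
    "card C = vec.dim (range ((*v) A))"
    using vec.basis_exists[of "range ((*v) A)"] by metis
  obtain D where D: "D \<subseteq> range ((*v) B)" "vec.independent D"
    "card D = vec.dim (range ((*v) B))"
    using vec.basis_exists[of "range ((*v) B)"] by metis
  have "finite C" "finite D"
    by (rule vec.finiteI_independent, fact)+
  moreover have "card C \<le> card D"
    using assms by (simp only: C(3) D(3))
  ultimately have "\<exists>p. p ` C \<subseteq> D \<and> inj_on p C"
    by (rule card_le_inj)
  then obtain p where p: "p ` C \<subseteq> D" "inj_on p C"
    by blast
  \<comment> \<open>\<open>q c\<close> is a chosen preimage of the basis vector \<open>p c\<close>
    under \<open>B\<close>.\<close>
  define q where "q c = inv ((*v) B) (p c)" for c
  have q: "B *v q c = p c" if "c \<in> C" for c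
    unfolding q_def by (rule f_inv_into_f) (use that p(1) D(1) in blast)
  obtain \<phi> where \<phi>: "Vector_Spaces.linear (*s) (*s) \<phi>" "\<And>c. c \<in> C \<Longrightarrow> \<phi> c = q c"
    using vec.linear_independent_extend[OF C(1), of q] by blast
  define M where "M = B ** matrix \<phi>"
  have M: "M *v c = p c" if "c \<in> C" for c
    using that by (simp add: M_def matrix_works[OF \<phi>(1)] \<phi>(2) q flip: matrix_vector_mul_assoc)
  \<comment> \<open>\<open>M\<close> maps \<open>C\<close> one-to-one into the independent set
    \<open>D\<close>, so it is injective on the whole span.\<close>
  have "vec.independent ((*v) M ` C)"
    by (rule vec.independent_mono[OF D(2)]) (use M p(1) in auto)
  moreover have "inj_on ((*v) M) C"
    using M p(2) by (simp add: inj_on_def)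
  ultimately have "inj_on ((*v) M) (vec.span C)"
    by (rule vec.linear_inj_on_span_independent_image[OF matrix_vector_mul_linear_gen])
  from vec.linear_exists_left_inverse_on[OF matrix_vector_mul_linear_gen vec.subspace_span this]
  obtain \<psi> where \<psi>: "Vector_Spaces.linear (*s) (*s) \<psi>"
    "\<And>y. y \<in> vec.span C \<Longrightarrow> \<psi> (M *v y) = y"
    by blast
  \<comment> \<open>\<open>\<psi>\<close> is known to undo \<open>M\<close> only on the span of
    \<open>C\<close>, but every \<open>A *v x\<close> lies there.\<close>
  have "A *v x = (matrix \<psi> ** B ** (matrix \<phi> ** A)) *v x" for x
    using \<psi>(2)[OF subsetD[OF C(2) rangeI], of x]
    by (simp add: M_def matrix_works[OF \<psi>(1)] flip: matrix_vector_mul_assoc)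
  then show ?thesis
    by (metis matrix_eq)
qed

lemma mat_half_add_mat_half:
  assumes "(2::'k::field) \<noteq> 0"
  shows "mat (1 / 2) + mat (1 / 2) = (mat 1 :: 'k^'n^'n)"
  using assms by (simp add: mat_def vec_eq_iff flip: add_divide_distrib)

context
  fixes \<sigma> :: "'k::field^'n^'n \<Rightarrow> 'k^'n^'n" and e :: "'k^'n^'n"
  assumes inv: "involution \<sigma>" and idem: "e ** e = e" and \<sigma>_e: "\<sigma> e = mat 1 - e"
begin

lemma involution_simps:
  "\<sigma> (x + y) = \<sigma> x + \<sigma> y" "\<sigma> (x ** y) = \<sigma> y ** \<sigma> x" "\<sigma> (mat 1) = mat 1" "\<sigma> (\<sigma> x) = x"
  using inv unfolding involution_def by blast+

lemma involution_complement: "\<sigma> (mat 1 - e) = e"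
  using involution_simps(4)[of e] by (simp add: \<sigma>_e)

lemma idempotent_factor: "\<exists>g h. e = g ** (mat 1 - e) ** h"
proof (cases "vec.dim (range ((*v) e)) \<le> vec.dim (range ((*v) (mat 1 - e)))")
  case True
  then show ?thesis
    by (rule factor_through_matrix_if_dim_le)
next
  case False
  then obtain g h where "mat 1 - e = g ** e ** h"
    using factor_through_matrix_if_dim_le[of "mat 1 - e" e] by auto
  \<comment> \<open>Here the complement factors through \<open>e\<close>; applying \<sigma>, which
    swaps the two idempotents, reverses the roles.\<close>
  then have "\<sigma> (mat 1 - e) = \<sigma> h ** (\<sigma> e ** \<sigma> g)"
    by (simp only: involution_simps)
  then show ?thesis
    by (metis involution_complement \<sigma>_e matrix_mul_assoc)
qed

text \<open>The right ideals eA and (1 - e)A are totally isotropic for the form \<sigma>(x) y,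
  because \<sigma>(e u) e = \<sigma>(u) (1 - e) e = 0 and likewise for 1 - e. Only the cross terms
  survive.\<close>

lemma hermitian_square_idempotent_decomposition:
  "\<sigma> (e ** u + (mat 1 - e) ** v) ** (e ** u + (mat 1 - e) ** v)
     = \<sigma> u ** (mat 1 - e) ** v + \<sigma> v ** e ** u"
proof -
  define f where "f = mat 1 - e"
  have "e ** f = 0" "f ** e = 0" "f ** f = f"
    by (simp_all add: f_def idem matrix_sub_ldistrib matrix_sub_rdistrib)
  then have "e ** (f ** x) = 0" "f ** (e ** x) = 0" "f ** (f ** x) = f ** x" "e ** (e ** x) = e ** x"
    for x :: "'k^'n^'n" by (simp_all add: matrix_mul_assoc idem)
  moreover have "\<sigma> e = f" "\<sigma> f = e"
    by (simp_all add: f_def \<sigma>_e involution_complement)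
  ultimately show ?thesis
    by (simp add: involution_simps matrix_add_ldistrib matrix_add_rdistrib
        flip: f_def matrix_mul_assoc)
qed

lemma symmetric_sum_of_hermitian_squares:
  assumes two: "(2::'k) \<noteq> 0" and a: "\<sigma> a = a"
  shows "sum_of_hermitian_squares \<sigma> a"
proof -
  define w where "w = mat (1 / 2) ** a"
  have ww: "w + w = a"
    by (simp only: w_def mat_half_add_mat_half[OF two] matrix_mul_lid flip: matrix_add_rdistrib)
  \<comment> \<open>An involution need not be K-linear, so the symmetry of \<open>w\<close> is
    obtained by halving both sides of \<sigma>(w) + \<sigma>(w) = \<sigma>(a) = a = w + w.\<close>
  have "mat (1 / 2) ** (w + w) = w"
    by (simp only: ww) (simp only: w_def)
  moreover have "mat (1 / 2) ** (\<sigma> w + \<sigma> w) = \<sigma> w"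
    by (simp only: matrix_add_ldistrib mat_half_add_mat_half[OF two] matrix_mul_lid
        flip: matrix_add_rdistrib)
  ultimately have w: "\<sigma> w = w"
    by (metis a involution_simps(1) ww)
  obtain g h where e: "e = g ** (mat 1 - e) ** h"
    using idempotent_factor by blast
  then have "\<sigma> e = \<sigma> h ** (\<sigma> (mat 1 - e) ** \<sigma> g)"
    by (metis involution_simps(2))
  then have f: "\<sigma> h ** e ** \<sigma> g = mat 1 - e"
    by (simp only: involution_complement \<sigma>_e matrix_mul_assoc)
  define x where "x = e ** mat 1 + (mat 1 - e) ** w"
  \<comment> \<open>With u = \<sigma>(g) and v = h w the cross terms are (g (1 - e) h) w and w
    (\<sigma>(h) e \<sigma>(g)), which the two factorizations \<open>e\<close> and \<open>f\<close>
    collapse to e w and w (1 - e).\<close>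
  define y where "y = e ** \<sigma> g + (mat 1 - e) ** (h ** w)"
  have "\<sigma> x ** x = (mat 1 - e) ** w + w ** e"
    unfolding x_def hermitian_square_idempotent_decomposition
    by (simp add: involution_simps w)
  moreover have "\<sigma> y ** y = (g ** (mat 1 - e) ** h) ** w + w ** (\<sigma> h ** e ** \<sigma> g)"
    unfolding y_def hermitian_square_idempotent_decomposition
    by (simp add: involution_simps w matrix_mul_assoc)
  then have "\<sigma> y ** y = e ** w + w ** (mat 1 - e)"
    by (simp only: f flip: e)
  ultimately have "a = (\<Sum>z\<leftarrow>[x, y]. \<sigma> z ** z)"
    by (simp add: ww matrix_sub_ldistrib matrix_sub_rdistrib)
  then show ?thesis
    unfolding sum_of_hermitian_squares_def by blast
qed

end

text \<open>In characteristic 2, -1 = 1 is itself a square.\<close>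

lemma formally_real_two_neq_zero:
  fixes F :: "'k::field set"
  assumes "formally_real F" "1 \<in> F"
  shows "(2::'k) \<noteq> 0"
proof
  assume "(2::'k) = 0"
  then have "- 1 = (\<Sum>x\<leftarrow>[1::'k]. x\<^sup>2)"
    by (simp add: neg_eq_iff_add_eq_0)
  then show False
    using assms unfolding formally_real_def
    by (metis empty_iff empty_set insert_iff list.simps(15) subsetI)
qed

theorem corollary4p5:
  fixes \<sigma> :: "'k::field^'n^'n \<Rightarrow> 'k^'n^'n" and l :: nat
  assumes "CARD('n) = 2 ^ l"
    and "involution \<sigma>"
    and "hyperbolic \<sigma>"
    and "formally_real (fixed_field \<sigma>)"
  shows "PS_Conjecture \<sigma>"
proof -
  have "1 \<in> fixed_field \<sigma>"
    using assms(2) by (simp add: fixed_field_def involution_def)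
  then have "(2::'k) \<noteq> 0"
    using assms(4) formally_real_two_neq_zero by blast
  then show ?thesis
    using assms(2,3) symmetric_sum_of_hermitian_squares
    unfolding PS_Conjecture_def totally_sigma_positive_def Sym_def hyperbolic_def by blast
qed

end
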